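(* Let $(W,S)$ be a finite Coxeter system. For all $x,y\in\Sigma W$, $$\langle \Phi(x),\Phi(y)\rangle_W=\langle x,y\rangle .$$
   Context: $\ell$ is the length function of $(W,S)$. For $I\subset S$, $W_I$ is the subgroup generated by $I$, $X_I=\{w\in W : \ell(ws)>\ell(w)\ \forall s\in I\}$ is the set of minimal length representatives of the left cosets $W/W_I$, and $x_I=\sum_{w\in X_I}w\in\mathbb{Q}W$. The Solomon descent algebra $\Sigma W$ is the $\mathbb{Q}$-span of $\{x_I\}_{I\subset S}$ in $\mathbb{Q}W$; it is a subalgebra and the $x_I$ form a basis of it. $\Phi$ is the $\mathbb{Q}$-linear map (the Solomon homomorphism, an algebra homomorphism) from $\Sigma W$ to the algebra of class functions on $W$ with $\Phi(x_I)=1_{W_I}^W$, the character of $W$ induced from the trivial character of $W_I$. On class functions, $\langle f,g\rangle_W=\frac{1}{|W|}\sum_{w\in W}f(w)g(w)$. On $\mathbb{Q}W$, $\langle\cdot,\cdot\rangle$ is the bilinear form with, for $w,g\in W$, $\langle w,g\rangle=1$ if $w=g^{-1}$ and $0$ otherwise. *)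

theory Defs
  imports "HOL-Algebra.Algebra" "HOL-Library.Function_Algebras"
begin

section \<open>Coxeter systems\<close>

text \<open>The element of the group represented by a word.\<close>

definition word_prod :: "('a, 'b) monoid_scheme \<Rightarrow> 'a list \<Rightarrow> 'a" where
  "word_prod G ws = foldr (\<lambda>x y. x \<otimes>\<^bsub>G\<^esub> y) ws \<one>\<^bsub>G\<^esub>"

text \<open>
  One application of a defining relation \<open>(s t)^m = 1\<close>, with \<open>m\<close> the order of \<open>s t\<close>, to a word
  over \<open>S\<close>. In \<open>HOL-Algebra\<close> an element of infinite order has \<open>ord = 0\<close>, in which case the
  relation is void, as it should be; for \<open>s = t\<close> it is the relation \<open>s s = 1\<close>.
\<close>

definition coxeter_step :: "('a, 'b) monoid_scheme \<Rightarrow> 'a set \<Rightarrow> 'a list \<Rightarrow> 'a list \<Rightarrow> bool" where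
  "coxeter_step G S us vs \<longleftrightarrow>
     (\<exists>s\<in>S. \<exists>t\<in>S. \<exists>xs\<in>lists S. \<exists>ys\<in>lists S.
        us = xs @ concat (replicate (group.ord G (s \<otimes>\<^bsub>G\<^esub> t)) [s, t]) @ ys \<and> vs = xs @ ys)"

text \<open>
  The last axiom says that \<open>\<langle>S | (s t)^m(s,t) = 1\<rangle>\<close> is a presentation of the group. Words without
  inverse letters suffice, because the relations \<open>s s = 1\<close> make the monoid given by this
  presentation a group, namely the group given by it.
\<close>

locale coxeter_system = group W for W (structure) and S +
  assumes gens_subset: "S \<subseteq> carrier W"
    and gens_generate: "generate W S = carrier W"
    and gens_order: "s \<in> S \<Longrightarrow> ord s = 2"
    and presentation:
      "us \<in> lists S \<Longrightarrow> vs \<in> lists S \<Longrightarrow> word_prod W us = word_prod W vs \<Longrightarrow>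
         equivclp (coxeter_step W S) us vs"

definition cox_length :: "('a, 'b) monoid_scheme \<Rightarrow> 'a set \<Rightarrow> 'a \<Rightarrow> nat" where
  "cox_length W S w = (LEAST n. \<exists>ws\<in>lists S. length ws = n \<and> word_prod W ws = w)"

definition min_coset_reps :: "('a, 'b) monoid_scheme \<Rightarrow> 'a set \<Rightarrow> 'a set \<Rightarrow> 'a set" where
  "min_coset_reps W S I =
     {w \<in> carrier W. \<forall>s\<in>I. cox_length W S (w \<otimes>\<^bsub>W\<^esub> s) > cox_length W S w}"


section \<open>The group algebra and the descent algebra\<close>

text \<open>
  An element \<open>\<Sum>w. a\<^sub>w w\<close> of the rational group algebra of a finite group is represented by its
  coefficient function \<open>w \<mapsto> a\<^sub>w\<close>, which is \<open>0\<close> outside the carrier.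
\<close>

definition fun_scale :: "rat \<Rightarrow> ('a \<Rightarrow> rat) \<Rightarrow> 'a \<Rightarrow> rat" where
  "fun_scale c f = (\<lambda>w. c * f w)"

global_interpretation rat_fun: vector_space "fun_scale :: rat \<Rightarrow> ('a \<Rightarrow> rat) \<Rightarrow> 'a \<Rightarrow> rat"
  defines rat_fun_span = rat_fun.span
  by unfold_locales (auto simp: fun_scale_def fun_eq_iff algebra_simps)

definition descent_elt :: "('a, 'b) monoid_scheme \<Rightarrow> 'a set \<Rightarrow> 'a set \<Rightarrow> 'a \<Rightarrow> rat" where
  "descent_elt W S I = (\<lambda>w. if w \<in> min_coset_reps W S I then 1 else 0)"

definition descent_algebra :: "('a, 'b) monoid_scheme \<Rightarrow> 'a set \<Rightarrow> ('a \<Rightarrow> rat) set" where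
  "descent_algebra W S = rat_fun_span (descent_elt W S ` Pow S)"

text \<open>The bilinear form with \<open>\<langle>w, g\<rangle> = 1\<close> if \<open>w\<close> is the inverse of \<open>g\<close>, and \<open>0\<close> otherwise.\<close>

definition group_algebra_form ::
    "('a, 'b) monoid_scheme \<Rightarrow> ('a \<Rightarrow> rat) \<Rightarrow> ('a \<Rightarrow> rat) \<Rightarrow> rat" where
  "group_algebra_form W x y =
     (\<Sum>w\<in>carrier W. \<Sum>g\<in>carrier W. x w * y g * (if w = inv\<^bsub>W\<^esub> g then 1 else 0))"


section \<open>Class functions and the Solomon homomorphism\<close>

text \<open>Like group algebra elements, class functions are extended by \<open>0\<close> outside the carrier.\<close>

definition class_fun_inner ::
    "('a, 'b) monoid_scheme \<Rightarrow> ('a \<Rightarrow> rat) \<Rightarrow> ('a \<Rightarrow> rat) \<Rightarrow> rat" where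
  "class_fun_inner W f g = (1 / of_nat (order W)) * (\<Sum>w\<in>carrier W. f w * g w)"

definition induced_class_fun ::
    "('a, 'b) monoid_scheme \<Rightarrow> 'a set \<Rightarrow> ('a \<Rightarrow> rat) \<Rightarrow> 'a \<Rightarrow> rat" where
  "induced_class_fun G H \<phi> = (\<lambda>g. if g \<in> carrier G
     then (1 / of_nat (card H)) *
       (\<Sum>h\<in>carrier G. let k = inv\<^bsub>G\<^esub> h \<otimes>\<^bsub>G\<^esub> g \<otimes>\<^bsub>G\<^esub> h in if k \<in> H then \<phi> k else 0)
     else 0)"

definition parabolic_char :: "('a, 'b) monoid_scheme \<Rightarrow> 'a set \<Rightarrow> 'a \<Rightarrow> rat" where
  "parabolic_char W I = induced_class_fun W (generate W I) (\<lambda>_. 1)"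

text \<open>
  Since the elements \<open>x\<^sub>I\<close> form a basis of the descent algebra, the coefficient family is determined
  by \<open>x\<close> (for \<open>I \<subseteq> S\<close>), so the map below is linear and sends \<open>x\<^sub>I\<close> to the induced character.
  By \<open>solomon_hom_unique\<close>, any linear map with these values agrees with it on the descent algebra.
\<close>

definition descent_coeffs ::
    "('a, 'b) monoid_scheme \<Rightarrow> 'a set \<Rightarrow> ('a \<Rightarrow> rat) \<Rightarrow> 'a set \<Rightarrow> rat" where
  "descent_coeffs W S x = (SOME c. x = (\<Sum>I\<in>Pow S. fun_scale (c I) (descent_elt W S I)))"

definition solomon_hom ::
    "('a, 'b) monoid_scheme \<Rightarrow> 'a set \<Rightarrow> ('a \<Rightarrow> rat) \<Rightarrow> 'a \<Rightarrow> rat" where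
  "solomon_hom W S x = (\<Sum>I\<in>Pow S. fun_scale (descent_coeffs W S x I) (parabolic_char W I))"

lemma descent_algebra_eq:
  assumes "finite S"
  shows "descent_algebra W S =
           range (\<lambda>c. \<Sum>I\<in>Pow S. fun_scale (c I) (descent_elt W S I))" (is "?A = ?B")
proof
  let ?x = "descent_elt W S"
  show "?B \<subseteq> ?A"
    unfolding descent_algebra_def
    by (intro image_subsetI rat_fun.span_sum rat_fun.span_scale rat_fun.span_base imageI)
  show "?A \<subseteq> ?B"
  proof
    fix x assume "x \<in> ?A"
    then show "x \<in> ?B"
      unfolding descent_algebra_def
    proof (induction rule: rat_fun.span_induct_alt)
      case base
      have "0 = (\<Sum>I\<in>Pow S. fun_scale 0 (?x I))" by simp
      then show ?case by (rule range_eqI[where x = "\<lambda>_. 0"])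
    next
      case (step a y z)
      then obtain I c where I: "I \<in> Pow S" "y = ?x I"
        and c: "z = (\<Sum>J\<in>Pow S. fun_scale (c J) (?x J))" by auto
      have "fun_scale a y = (\<Sum>J\<in>Pow S. fun_scale (if J = I then a else 0) (?x J))"
        using I assms by (subst sum.remove[of _ I]) (auto intro!: sum.neutral)
      then have "fun_scale a y + z =
          (\<Sum>J\<in>Pow S. fun_scale ((if J = I then a else 0) + c J) (?x J))"
        by (simp add: c rat_fun.scale_left_distrib sum.distrib)
      then show ?case
        by (rule range_eqI[where x = "\<lambda>J. (if J = I then a else 0) + c J"])
    qed
  qed
qed

lemma descent_coeffs:
  assumes "finite S" and "x \<in> descent_algebra W S"
  shows "x = (\<Sum>I\<in>Pow S. fun_scale (descent_coeffs W S x I) (descent_elt W S I))"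
proof -
  have "\<exists>c. x = (\<Sum>I\<in>Pow S. fun_scale (c I) (descent_elt W S I))"
    using assms(2) unfolding descent_algebra_eq[OF assms(1)] by (elim rangeE) (rule exI)
  then show ?thesis
    unfolding descent_coeffs_def by (rule someI_ex)
qed

lemma solomon_hom_unique:
  assumes fin: "finite S"
    and add: "\<And>x y. x \<in> descent_algebra W S \<Longrightarrow> y \<in> descent_algebra W S \<Longrightarrow>
                 F (x + y) = F x + F y"
    and scale: "\<And>c x. x \<in> descent_algebra W S \<Longrightarrow> F (fun_scale c x) = fun_scale c (F x)"
    and vals: "\<And>I. I \<subseteq> S \<Longrightarrow> F (descent_elt W S I) = parabolic_char W I"
    and x: "x \<in> descent_algebra W S"
  shows "F x = solomon_hom W S x"
proof -
  let ?x = "descent_elt W S"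
  have mem: "?x I \<in> descent_algebra W S" if "I \<in> Pow S" for I
    unfolding descent_algebra_def using that by (intro rat_fun.span_base) auto
  have zero: "0 \<in> descent_algebra W S"
    unfolding descent_algebra_def by (rule rat_fun.span_zero)
  have F0: "F 0 = 0"
    using scale[OF zero, of 0] unfolding rat_fun.scale_zero_left .
  have F_sum: "F (\<Sum>I\<in>A. fun_scale (c I) (?x I)) = (\<Sum>I\<in>A. fun_scale (c I) (parabolic_char W I))"
    if "finite A" "A \<subseteq> Pow S" for A c
    using that
  proof (induction A rule: finite_induct)
    case empty
    show ?case unfolding sum.empty by (rule F0)
  next
    case (insert I A)
    have "fun_scale (c I) (?x I) \<in> descent_algebra W S"
      using insert.prems mem unfolding descent_algebra_def by (intro rat_fun.span_scale) auto
    moreover have "(\<Sum>J\<in>A. fun_scale (c J) (?x J)) \<in> descent_algebra W S"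
      using insert.prems mem unfolding descent_algebra_def
      by (intro rat_fun.span_sum rat_fun.span_scale) auto
    moreover have "F (fun_scale (c I) (?x I)) = fun_scale (c I) (parabolic_char W I)"
      using insert.prems mem by (simp add: scale vals)
    moreover have "F (\<Sum>J\<in>A. fun_scale (c J) (?x J)) =
        (\<Sum>J\<in>A. fun_scale (c J) (parabolic_char W J))"
      using insert.IH insert.prems by blast
    ultimately show ?case
      unfolding sum.insert[OF insert.hyps] by (metis add)
  qed
  have "F x = F (\<Sum>I\<in>Pow S. fun_scale (descent_coeffs W S x I) (?x I))"
    using descent_coeffs[OF fin x] by simp
  also have "\<dots> = solomon_hom W S x"
    unfolding solomon_hom_def using fin by (intro F_sum) auto
  finally show ?thesis .
qed

end

theory Submission
  imports Defs
begin

text \<open>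
  Both forms are bilinear and \<open>x = \<Sum>\<^sub>I c\<^sub>I x\<^sub>I\<close> is sent to \<open>\<Sum>\<^sub>I c\<^sub>I \<Phi>(x\<^sub>I)\<close>, so it is
  enough to compare \<open>\<langle>\<Phi>(x\<^sub>I), \<Phi>(x\<^sub>J)\<rangle>\<close> with \<open>\<langle>x\<^sub>I, x\<^sub>J\<rangle>\<close>. Each of these numbers is the number of
  double cosets in \<open>W\<^sub>I \ W / W\<^sub>J\<close>.

  On the group algebra side, \<open>\<langle>x\<^sub>I, x\<^sub>J\<rangle>\<close> counts the \<open>d \<in> X\<^sub>J\<close> with \<open>d\<inverse> \<in> X\<^sub>I\<close>, that is, the \<open>d\<close> that
  become longer under left multiplication by elements of \<open>I\<close> and under right multiplication by
  elements of \<open>J\<close>. Every double coset contains exactly one such element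
  (\<open>double_reps_unique\<close>). An element of minimal length in the double coset is one, because
  multiplication by a generator always changes the length. If \<open>d\<close> is another one, write \<open>d = u v z\<close>
  with \<open>v\<close> a reduced word of the shortest element and \<open>u\<close>, \<open>z\<close> words over \<open>I\<close>, \<open>J\<close> of least
  total length; if \<open>u\<close> or \<open>z\<close> were nonempty, the exchange condition would delete a letter of
  \<open>u\<close> or \<open>z\<close>, against this choice, or of \<open>v\<close>, against the minimality of its length.

  On the character side, the inner product of the permutation characters on the cosets of two
  subgroups \<open>H\<close> and \<open>K\<close> of any finite group is the number of their double cosets
  (\<open>inner_induced_trivial\<close>). With a transversal \<open>D\<close> of the double cosets at hand this is a count
  of the triples \<open>(h, c, k)\<close> with \<open>h c k \<in> D\<close> in two ways.

  The exchange condition itself has to be derived from the presentation. To a word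
  \<open>s\<^sub>1 \<dots> s\<^sub>n\<close> belong the reflections \<open>s\<^sub>1 \<dots> s\<^sub>i \<dots> s\<^sub>1\<close>. How often a given element \<open>t\<close> occurs among
  them depends on the word, but the parity of this number does not change under the
  defining relations (\<open>refl_parity_cong\<close>), so it is a function of the group element. If it is
  odd then \<open>t\<close> occurs for every word of that element, and multiplying by \<open>t\<close> deletes a letter.
\<close>

section \<open>Inner products of permutation characters\<close>

lemma (in group) cancel_left:
  assumes "x \<in> carrier G" "y \<in> carrier G"
  shows "x \<otimes> (inv x \<otimes> y) = y" "inv x \<otimes> (x \<otimes> y) = y"
  using assms by (simp_all add: m_assoc[symmetric])

text \<open>
  The pairs \<open>(h, k)\<close> carrying \<open>c\<close> into \<open>D\<close> all carry it to the same element, and such pairs form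
  a torsor under the stabilizer of \<open>c\<close> for the action of \<open>H \<times> K\<close>, a group isomorphic to
  \<open>H \<inter> c K c\<inverse>\<close>: after the choice of one pair \<open>(h\<^sub>0, k\<^sub>0)\<close>, an element \<open>x\<close> of this intersection gives the pair \<open>(h\<^sub>0 x, c\<inverse> x\<inverse> c k\<^sub>0)\<close>.
\<close>

lemma (in group) card_double_coset_fibre:
  assumes H: "subgroup H G" and K: "subgroup K G" and D: "D \<subseteq> carrier G"
    and c: "c \<in> carrier G"
    and uniq: "\<exists>!d. d \<in> D \<and> (\<exists>h\<in>H. \<exists>k\<in>K. d = h \<otimes> c \<otimes> k)"
  shows "card {h \<in> H. inv c \<otimes> h \<otimes> c \<in> K} = card {p \<in> H \<times> K. fst p \<otimes> c \<otimes> snd p \<in> D}"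
proof -
  note [simp] = cancel_left m_assoc inv_mult_group c
  have HG [simp]: "h \<in> carrier G" if "h \<in> H" for h using that subgroup.mem_carrier[OF H] by simp
  have KG [simp]: "k \<in> carrier G" if "k \<in> K" for k using that subgroup.mem_carrier[OF K] by simp
  obtain h0 k0 where h0: "h0 \<in> H" and k0: "k0 \<in> K" and d0: "h0 \<otimes> c \<otimes> k0 \<in> D"
    using uniq by blast
  have same: "h \<otimes> c \<otimes> k = h0 \<otimes> c \<otimes> k0" if "h \<in> H" "k \<in> K" "h \<otimes> c \<otimes> k \<in> D" for h k
    using uniq that h0 k0 d0 by blast
  have conj: "inv c \<otimes> (inv h0 \<otimes> h) \<otimes> c = k0 \<otimes> inv k"
    if "h \<in> H" "k \<in> K" "h \<otimes> c \<otimes> k \<in> D" for h k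
  proof -
    have "inv c \<otimes> (inv h0 \<otimes> h) \<otimes> c = inv c \<otimes> inv h0 \<otimes> (h \<otimes> c \<otimes> k) \<otimes> inv k"
      using that h0 by simp
    also have "\<dots> = inv c \<otimes> inv h0 \<otimes> (h0 \<otimes> c \<otimes> k0) \<otimes> inv k"
      by (simp only: same[OF that])
    also have "\<dots> = k0 \<otimes> inv k" using that h0 k0 by simp
    finally show ?thesis .
  qed
  have "bij_betw (\<lambda>x. (h0 \<otimes> x, inv c \<otimes> inv x \<otimes> c \<otimes> k0))
          {h \<in> H. inv c \<otimes> h \<otimes> c \<in> K} {p \<in> H \<times> K. fst p \<otimes> c \<otimes> snd p \<in> D}"
  proof (rule bij_betw_byWitness[where f' = "\<lambda>p. inv h0 \<otimes> fst p"])
    show "\<forall>x\<in>{h \<in> H. inv c \<otimes> h \<otimes> c \<in> K}.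
            inv h0 \<otimes> fst (h0 \<otimes> x, inv c \<otimes> inv x \<otimes> c \<otimes> k0) = x"
      using h0 by simp
    show "\<forall>p\<in>{p \<in> H \<times> K. fst p \<otimes> c \<otimes> snd p \<in> D}.
        (h0 \<otimes> (inv h0 \<otimes> fst p), inv c \<otimes> inv (inv h0 \<otimes> fst p) \<otimes> c \<otimes> k0) = p"
    proof
      fix p assume "p \<in> {p \<in> H \<times> K. fst p \<otimes> c \<otimes> snd p \<in> D}"
      then obtain h k where p: "p = (h, k)" and hk: "h \<in> H" "k \<in> K" "h \<otimes> c \<otimes> k \<in> D"
        by (cases p) auto
      have "inv c \<otimes> inv (inv h0 \<otimes> h) \<otimes> c \<otimes> k0 = inv (inv c \<otimes> (inv h0 \<otimes> h) \<otimes> c) \<otimes> k0"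
        using hk h0 k0 by simp
      also have "\<dots> = inv (k0 \<otimes> inv k) \<otimes> k0" unfolding conj[OF hk] ..
      also have "\<dots> = k" using hk k0 by simp
      finally show "(h0 \<otimes> (inv h0 \<otimes> fst p), inv c \<otimes> inv (inv h0 \<otimes> fst p) \<otimes> c \<otimes> k0) = p"
        using hk h0 unfolding p by simp
    qed
    show "(\<lambda>x. (h0 \<otimes> x, inv c \<otimes> inv x \<otimes> c \<otimes> k0)) ` {h \<in> H. inv c \<otimes> h \<otimes> c \<in> K}
        \<subseteq> {p \<in> H \<times> K. fst p \<otimes> c \<otimes> snd p \<in> D}"
    proof (rule image_subsetI)
      fix x assume "x \<in> {h \<in> H. inv c \<otimes> h \<otimes> c \<in> K}"
      then have x: "x \<in> H" "inv c \<otimes> x \<otimes> c \<in> K" by auto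
      have "h0 \<otimes> x \<in> H" using x h0 H by (simp add: subgroup.m_closed)
      have "inv (inv c \<otimes> x \<otimes> c) \<otimes> k0 \<in> K"
        using x k0 K by (metis subgroup.m_closed subgroup.m_inv_closed)
      then have "inv c \<otimes> inv x \<otimes> c \<otimes> k0 \<in> K" using x k0 by simp
      moreover have "(h0 \<otimes> x) \<otimes> c \<otimes> (inv c \<otimes> inv x \<otimes> c \<otimes> k0) \<in> D"
        using x h0 k0 d0 by simp
      ultimately show "(h0 \<otimes> x, inv c \<otimes> inv x \<otimes> c \<otimes> k0) \<in> {p \<in> H \<times> K. fst p \<otimes> c \<otimes> snd p \<in> D}"
        using \<open>h0 \<otimes> x \<in> H\<close> by (simp del: m_assoc)
    qed
    show "(\<lambda>p. inv h0 \<otimes> fst p) ` {p \<in> H \<times> K. fst p \<otimes> c \<otimes> snd p \<in> D}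
        \<subseteq> {h \<in> H. inv c \<otimes> h \<otimes> c \<in> K}"
    proof (rule image_subsetI)
      fix p assume "p \<in> {p \<in> H \<times> K. fst p \<otimes> c \<otimes> snd p \<in> D}"
      then obtain h k where p: "p = (h, k)" and hk: "h \<in> H" "k \<in> K" "h \<otimes> c \<otimes> k \<in> D"
        by (cases p) auto
      have "inv h0 \<otimes> h \<in> H"
        using hk h0 H by (simp add: subgroup.m_closed subgroup.m_inv_closed)
      have "k0 \<otimes> inv k \<in> K" using hk k0 K by (metis subgroup.m_closed subgroup.m_inv_closed)
      then have "inv c \<otimes> (inv h0 \<otimes> h) \<otimes> c \<in> K" unfolding conj[OF hk] .
      with \<open>inv h0 \<otimes> h \<in> H\<close> show "inv h0 \<otimes> fst p \<in> {h \<in> H. inv c \<otimes> h \<otimes> c \<in> K}"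
        unfolding p by simp
    qed
  qed
  then show ?thesis by (rule bij_betw_same_card)
qed

text \<open>
  Double counting of the triples \<open>(h, c, k)\<close> with \<open>h c k \<in> D\<close>. For fixed \<open>c\<close> they are counted by the
  preceding lemma; for fixed \<open>(h, k)\<close> there are as many as elements of \<open>D\<close>, since
  \<open>c \<mapsto> h c k\<close> is a bijection of the group.
\<close>

lemma (in group) sum_card_conj_inter:
  assumes fin: "finite (carrier G)"
    and H: "subgroup H G" and K: "subgroup K G" and D: "D \<subseteq> carrier G"
    and uniq: "\<And>c. c \<in> carrier G \<Longrightarrow> \<exists>!d. d \<in> D \<and> (\<exists>h\<in>H. \<exists>k\<in>K. d = h \<otimes> c \<otimes> k)"
  shows "(\<Sum>c\<in>carrier G. card {h \<in> H. inv c \<otimes> h \<otimes> c \<in> K}) = card H * card K * card D"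
proof -
  note [simp] = cancel_left m_assoc inv_mult_group
  have HG [simp]: "h \<in> carrier G" if "h \<in> H" for h using that subgroup.mem_carrier[OF H] by simp
  have KG [simp]: "k \<in> carrier G" if "k \<in> K" for k using that subgroup.mem_carrier[OF K] by simp
  have finHK: "finite (H \<times> K)"
    using fin subgroup.subset[OF H] subgroup.subset[OF K] by (auto intro: finite_subset)
  have "(\<Sum>c\<in>carrier G. card {h \<in> H. inv c \<otimes> h \<otimes> c \<in> K})
      = (\<Sum>c\<in>carrier G. card {p \<in> H \<times> K. fst p \<otimes> c \<otimes> snd p \<in> D})"
    by (intro sum.cong refl card_double_coset_fibre H K D uniq)
  also have "\<dots> = (\<Sum>c\<in>carrier G. \<Sum>p\<in>H \<times> K. if fst p \<otimes> c \<otimes> snd p \<in> D then 1 else 0)"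
    by (intro sum.cong refl) (simp add: finHK flip: sum.inter_filter)
  also have "\<dots> = (\<Sum>p\<in>H \<times> K. \<Sum>c\<in>carrier G. if fst p \<otimes> c \<otimes> snd p \<in> D then 1 else 0)"
    by (rule sum.swap)
  also have "\<dots> = (\<Sum>p\<in>H \<times> K. card {c \<in> carrier G. fst p \<otimes> c \<otimes> snd p \<in> D})"
    by (intro sum.cong refl) (simp add: fin flip: sum.inter_filter)
  also have "\<dots> = (\<Sum>p\<in>H \<times> K. card D)"
  proof (intro sum.cong refl)
    fix p assume "p \<in> H \<times> K"
    then obtain h k where p: "p = (h, k)" "h \<in> H" "k \<in> K" by auto
    have "bij_betw (\<lambda>c. h \<otimes> c \<otimes> k) {c \<in> carrier G. h \<otimes> c \<otimes> k \<in> D} D"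
      by (rule bij_betw_byWitness[where f' = "\<lambda>d. inv h \<otimes> d \<otimes> inv k"]) (use p D in auto)
    then show "card {c \<in> carrier G. fst p \<otimes> c \<otimes> snd p \<in> D} = card D"
      using p by (simp add: bij_betw_same_card)
  qed
  also have "\<dots> = card H * card K * card D" by (simp add: card_cartesian_product)
  finally show ?thesis .
qed

text \<open>
  Mackey's formula for trivial characters, with the double cosets represented by a transversal
  \<open>D\<close>. Expanding both induced characters gives a sum over \<open>g\<close> and two conjugating elements
  \<open>a\<close>, \<open>b\<close>; it depends only on \<open>h = a\<inverse> g a\<close> and \<open>c = a\<inverse> b\<close>, which makes the sum over \<open>a\<close> a factor
  \<open>|G|\<close> and leaves \<open>\<Sum>\<^sub>c |H \<inter> c K c\<inverse>|\<close>.
\<close>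

lemma (in group) inner_induced_trivial:
  assumes fin: "finite (carrier G)"
    and H: "subgroup H G" and K: "subgroup K G" and D: "D \<subseteq> carrier G"
    and uniq: "\<And>c. c \<in> carrier G \<Longrightarrow> \<exists>!d. d \<in> D \<and> (\<exists>h\<in>H. \<exists>k\<in>K. d = h \<otimes> c \<otimes> k)"
  shows "class_fun_inner G (induced_class_fun G H (\<lambda>_. 1)) (induced_class_fun G K (\<lambda>_. 1))
    = of_nat (card D)"
proof -
  note [simp] = cancel_left m_assoc inv_mult_group
  let ?C = "carrier G"
  let ?b = "\<lambda>P. (if P then 1 else 0) :: rat"
  have HG: "H \<subseteq> ?C" and KG: "K \<subseteq> ?C" using H K by (auto dest: subgroup.subset)
  have finH: "finite H" and finK: "finite K" using fin HG KG by (auto intro: finite_subset)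
  have pos: "card H \<noteq> 0" "card K \<noteq> 0" "card ?C \<noteq> 0"
    using finH finK fin subgroup.one_closed[OF H] subgroup.one_closed[OF K] one_closed
    by (auto simp: card_eq_0_iff)
  have "(\<Sum>g\<in>?C. (\<Sum>a\<in>?C. ?b (inv a \<otimes> g \<otimes> a \<in> H)) * (\<Sum>b\<in>?C. ?b (inv b \<otimes> g \<otimes> b \<in> K)))
      = (\<Sum>g\<in>?C. \<Sum>a\<in>?C. \<Sum>b\<in>?C. ?b (inv a \<otimes> g \<otimes> a \<in> H) * ?b (inv b \<otimes> g \<otimes> b \<in> K))"
    by (simp only: sum_product)
  also have "\<dots> = (\<Sum>a\<in>?C. \<Sum>g\<in>?C. \<Sum>b\<in>?C. ?b (inv a \<otimes> g \<otimes> a \<in> H) * ?b (inv b \<otimes> g \<otimes> b \<in> K))"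
    by (rule sum.swap)
  also have "\<dots> = (\<Sum>a\<in>?C. \<Sum>h\<in>?C. \<Sum>c\<in>?C. ?b (h \<in> H) * ?b (inv c \<otimes> h \<otimes> c \<in> K))"
  proof (rule sum.cong[OF refl])
    fix a assume a [simp]: "a \<in> ?C"
    have "(\<Sum>b\<in>?C. ?b (inv a \<otimes> (a \<otimes> h \<otimes> inv a) \<otimes> a \<in> H) * ?b (inv b \<otimes> (a \<otimes> h \<otimes> inv a) \<otimes> b \<in> K))
        = (\<Sum>c\<in>?C. ?b (h \<in> H) * ?b (inv c \<otimes> h \<otimes> c \<in> K))" if "h \<in> ?C" for h
      by (rule sum.reindex_bij_witness[where i = "\<lambda>c. a \<otimes> c" and j = "\<lambda>b. inv a \<otimes> b"])
        (use that in auto)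
    note inner = this
    show "(\<Sum>g\<in>?C. \<Sum>b\<in>?C. ?b (inv a \<otimes> g \<otimes> a \<in> H) * ?b (inv b \<otimes> g \<otimes> b \<in> K))
        = (\<Sum>h\<in>?C. \<Sum>c\<in>?C. ?b (h \<in> H) * ?b (inv c \<otimes> h \<otimes> c \<in> K))"
    proof (rule sum.reindex_bij_witness[where i = "\<lambda>h. a \<otimes> h \<otimes> inv a" and j = "\<lambda>g. inv a \<otimes> g \<otimes> a"])
      fix g assume g: "g \<in> ?C"
      have eq: "a \<otimes> (inv a \<otimes> g \<otimes> a) \<otimes> inv a = g" using g by simp
      have "inv a \<otimes> g \<otimes> a \<in> ?C" using g by simp
      from inner[OF this, unfolded eq]
      show "(\<Sum>c\<in>?C. ?b (inv a \<otimes> g \<otimes> a \<in> H) * ?b (inv c \<otimes> (inv a \<otimes> g \<otimes> a) \<otimes> c \<in> K))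
        = (\<Sum>b\<in>?C. ?b (inv a \<otimes> g \<otimes> a \<in> H) * ?b (inv b \<otimes> g \<otimes> b \<in> K))"
        by (rule sym)
    qed auto
  qed
  also have "\<dots> = of_nat (card ?C) * (\<Sum>c\<in>?C. \<Sum>h\<in>?C. ?b (h \<in> H) * ?b (inv c \<otimes> h \<otimes> c \<in> K))"
    unfolding sum_constant by (subst sum.swap) (rule refl)
  also have "(\<Sum>c\<in>?C. \<Sum>h\<in>?C. ?b (h \<in> H) * ?b (inv c \<otimes> h \<otimes> c \<in> K))
      = (\<Sum>c\<in>?C. of_nat (card {h \<in> H. inv c \<otimes> h \<otimes> c \<in> K}))"
  proof (intro sum.cong refl)
    fix c assume "c \<in> ?C"
    have "(\<Sum>h\<in>?C. ?b (h \<in> H) * ?b (inv c \<otimes> h \<otimes> c \<in> K))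
        = (\<Sum>h\<in>{h \<in> ?C. h \<in> H \<and> inv c \<otimes> h \<otimes> c \<in> K}. 1)"
      unfolding sum.inter_filter[OF fin] by (intro sum.cong) auto
    also have "{h \<in> ?C. h \<in> H \<and> inv c \<otimes> h \<otimes> c \<in> K} = {h \<in> H. inv c \<otimes> h \<otimes> c \<in> K}"
      using HG by auto
    finally show "(\<Sum>h\<in>?C. ?b (h \<in> H) * ?b (inv c \<otimes> h \<otimes> c \<in> K))
        = of_nat (card {h \<in> H. inv c \<otimes> h \<otimes> c \<in> K})"
      by simp
  qed
  also have "\<dots> = of_nat (card H * card K * card D)"
    by (simp only: sum_card_conj_inter[OF fin H K D uniq, symmetric] of_nat_sum)
  finally have main: "(\<Sum>g\<in>?C. (\<Sum>a\<in>?C. ?b (inv a \<otimes> g \<otimes> a \<in> H)) * (\<Sum>b\<in>?C. ?b (inv b \<otimes> g \<otimes> b \<in> K)))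
      = of_nat (card ?C) * of_nat (card H * card K * card D)" .
  have "class_fun_inner G (induced_class_fun G H (\<lambda>_. 1)) (induced_class_fun G K (\<lambda>_. 1))
     = 1 / of_nat (card ?C) * (\<Sum>g\<in>?C. (1 / of_nat (card H) * (1 / of_nat (card K))) *
        ((\<Sum>a\<in>?C. ?b (inv a \<otimes> g \<otimes> a \<in> H)) * (\<Sum>b\<in>?C. ?b (inv b \<otimes> g \<otimes> b \<in> K))))"
    unfolding class_fun_inner_def induced_class_fun_def order_def Let_def
    by (rule arg_cong2[OF refl sum.cong[OF refl], where f = "(*)"]) (simp del: m_assoc)
  also have "\<dots> = of_nat (card D)"
    unfolding sum_distrib_left[symmetric] main using pos by simp
  finally show ?thesis .
qed


section \<open>The exchange condition\<close>

context coxeter_system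
begin

abbreviation wp :: "'a list \<Rightarrow> 'a" where "wp \<equiv> word_prod W"

abbreviation len :: "'a \<Rightarrow> nat" where "len \<equiv> cox_length W S"

lemma gen_closed [simp]: "s \<in> S \<Longrightarrow> s \<in> carrier W"
  using gens_subset by auto

lemma gen_square [simp]: "s \<in> S \<Longrightarrow> s \<otimes> s = \<one>"
  using pow_ord_eq_1[of s] gens_order[of s] by (simp add: numeral_2_eq_2)

lemma gen_inv [simp]: "s \<in> S \<Longrightarrow> inv s = s"
  by (simp add: inv_equality)

lemma gen_cancel [simp]: "s \<in> S \<Longrightarrow> x \<in> carrier W \<Longrightarrow> s \<otimes> (s \<otimes> x) = x"
  by (simp add: m_assoc[symmetric])

lemma wp_Nil [simp]: "wp [] = \<one>"
  and wp_Cons [simp]: "wp (s # ws) = s \<otimes> wp ws"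
  by (simp_all add: word_prod_def)

lemma wp_closed [simp]: "ws \<in> lists S \<Longrightarrow> wp ws \<in> carrier W"
  by (induction ws) auto

lemma wp_append: "us \<in> lists S \<Longrightarrow> vs \<in> lists S \<Longrightarrow> wp (us @ vs) = wp us \<otimes> wp vs"
  by (induction us) (auto simp: m_assoc)

lemma rev_in_lists [simp]: "rev ws \<in> lists A \<longleftrightarrow> ws \<in> lists A"
  by (simp add: in_lists_conv_set)

lemma wp_rev: "ws \<in> lists S \<Longrightarrow> wp (rev ws) = inv (wp ws)"
  by (induction ws) (auto simp: wp_append inv_mult_group)

lemma wp_alternating:
  "s \<in> S \<Longrightarrow> t \<in> S \<Longrightarrow> wp (concat (replicate n [s, t])) = (s \<otimes> t) [^] n"
proof (induction n)
  case (Suc n)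
  have "(s \<otimes> t) [^] Suc n = (s \<otimes> t) \<otimes> (s \<otimes> t) [^] n"
    using Suc.prems by (intro nat_pow_Suc2) simp
  then show ?case using Suc by (simp add: m_assoc del: nat_pow_Suc)
qed simp

lemma alternating_in_lists: "s \<in> S \<Longrightarrow> t \<in> S \<Longrightarrow> concat (replicate n [s, t]) \<in> lists S"
  by (induction n) auto

text \<open>Generators are involutions, so inverses need no letters of their own.\<close>

lemma parabolic_words:
  assumes "I \<subseteq> S"
  shows "generate W I = wp ` lists I"
proof
  show "generate W I \<subseteq> wp ` lists I"
  proof
    fix x assume "x \<in> generate W I"
    then show "x \<in> wp ` lists I"
    proof (induction rule: generate.induct)
      case one
      show ?case by (rule image_eqI[of _ _ "[]"]) auto
    next
      case (incl s)
      then show ?case using assms by (intro image_eqI[of _ _ "[s]"]) auto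
    next
      case (inv s)
      then show ?case using assms by (intro image_eqI[of _ _ "[s]"]) auto
    next
      case (eng x y)
      then obtain us vs where *: "us \<in> lists I" "vs \<in> lists I" "x = wp us" "y = wp vs" by blast
      then have "x \<otimes> y = wp (us @ vs)" using lists_mono[OF assms] by (metis subsetD wp_append)
      then show ?case using * by (intro image_eqI[of _ _ "us @ vs"]) auto
    qed
  qed
  have "wp ws \<in> generate W I" if "ws \<in> lists I" for ws
    using that by (induction ws) (auto intro: generate.intros)
  then show "wp ` lists I \<subseteq> generate W I" by auto
qed

lemma parabolic_subgroup: "I \<subseteq> S \<Longrightarrow> subgroup (generate W I) W"
  using gens_subset by (intro generate_is_subgroup) auto

lemma len_le: "ws \<in> lists S \<Longrightarrow> len (wp ws) \<le> length ws"
  unfolding cox_length_def by (rule Least_le) auto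

lemma obtain_reduced_word:
  assumes "w \<in> carrier W"
  obtains ws where "ws \<in> lists S" "wp ws = w" "length ws = len w"
proof -
  have "\<exists>n. \<exists>ws\<in>lists S. length ws = n \<and> wp ws = w"
    using assms parabolic_words[of S] gens_generate by auto
  from LeastI_ex[OF this] show ?thesis using that unfolding cox_length_def by blast
qed

lemma len_inv: 
  assumes "w \<in> carrier W"
  shows "len (inv w) = len w"
proof -
  have le: "len (inv v) \<le> len v" if v: "v \<in> carrier W" for v
  proof -
    obtain ws where "ws \<in> lists S" "wp ws = v" "length ws = len v"
      using obtain_reduced_word[OF v] by blast
    then show ?thesis using len_le[of "rev ws"] by (auto simp: wp_rev)
  qed
  show ?thesis using le[of w] le[of "inv w"] assms by simp
qed

text \<open>
  The parity of the number of indices \<open>i\<close> with \<open>t = s\<^sub>1 \<dots> s\<^sub>i\<^sub>-\<^sub>1 s\<^sub>i s\<^sub>i\<^sub>-\<^sub>1 \<dots> s\<^sub>1\<close>; the recursion conjugates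
  \<open>t\<close> by the first letter, because all reflections after the first one are conjugates by \<open>s\<^sub>1\<close> of
  the reflections of the remaining word.
\<close>

fun refl_parity :: "'a list \<Rightarrow> 'a \<Rightarrow> bool" where
  "refl_parity [] t \<longleftrightarrow> False"
| "refl_parity (s # ws) t \<longleftrightarrow> (t = s) \<noteq> refl_parity ws (s \<otimes> t \<otimes> s)"

lemma refl_parity_append:
  assumes "us \<in> lists S" "t \<in> carrier W"
  shows "refl_parity (us @ vs) t \<longleftrightarrow>
    refl_parity us t \<noteq> refl_parity vs (inv (wp us) \<otimes> t \<otimes> wp us)"
  using assms
proof (induction us arbitrary: t)
  case (Cons s us)
  then have "inv (wp us) \<otimes> (s \<otimes> t \<otimes> s) \<otimes> wp us = inv (wp (s # us)) \<otimes> t \<otimes> wp (s # us)"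
    by (auto simp: inv_mult_group m_assoc)
  with Cons show ?case by auto
qed simp

text \<open>
  The reflections of the word \<open>s t s t \<dots>\<close> are the elements \<open>(s t)\<^sup>j s\<close>. In the inductive step the
  two new letters contribute \<open>c\<^sup>n s c\<^sup>-\<^sup>n = c\<^sup>2\<^sup>n s\<close> and \<open>c\<^sup>n (s t s) c\<^sup>-\<^sup>n = c\<^sup>2\<^sup>n\<^sup>+\<^sup>1 s\<close>, where \<open>c = s t\<close>
  is inverted by conjugation with \<open>s\<close>.
\<close>

lemma refl_parity_alternating:
  assumes s: "s \<in> S" and t: "t \<in> S" and r: "r \<in> carrier W"
  shows "refl_parity (concat (replicate n [s, t])) r \<longleftrightarrow>
    odd (\<Sum>j<2 * n. if r = (s \<otimes> t) [^] j \<otimes> s then 1 else 0 :: nat)"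
proof (induction n)
  case (Suc n)
  let ?c = "s \<otimes> t"
  let ?R = "concat (replicate n [s, t])"
  note [simp] = cancel_left m_assoc inv_mult_group s t r
  have flip: "s \<otimes> inv (?c [^] k) = ?c [^] k \<otimes> s" for k :: nat
  proof (induction k)
    case (Suc k)
    have "s \<otimes> inv (?c [^] Suc k) = s \<otimes> inv (?c [^] k \<otimes> ?c)" by simp
    also have "\<dots> = s \<otimes> t \<otimes> (s \<otimes> inv (?c [^] k))" by simp
    also have "\<dots> = (?c \<otimes> ?c [^] k) \<otimes> s" by (simp only: Suc) simp
    also have "?c \<otimes> ?c [^] k = ?c [^] Suc k"
      by (simp only: nat_pow_Suc2[of ?c] m_closed gen_closed s t)
    finally show ?case .
  qed simp
  have conj: "inv (?c [^] n) \<otimes> r \<otimes> ?c [^] n = u \<longleftrightarrow> r = ?c [^] n \<otimes> u \<otimes> inv (?c [^] n)"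
    if "u \<in> carrier W" for u
    using that by (auto simp: m_assoc)
  have e1: "inv (?c [^] n) \<otimes> r \<otimes> ?c [^] n = s \<longleftrightarrow> r = ?c [^] (2 * n) \<otimes> s"
  proof -
    have "?c [^] n \<otimes> s \<otimes> inv (?c [^] n) = ?c [^] n \<otimes> (s \<otimes> inv (?c [^] n))" by simp
    also have "\<dots> = ?c [^] n \<otimes> ?c [^] n \<otimes> s" unfolding flip by simp
    also have "?c [^] n \<otimes> ?c [^] n = ?c [^] (2 * n)" by (simp add: nat_pow_mult mult_2)
    finally show ?thesis using conj[of s] by simp
  qed
  have e2: "s \<otimes> (inv (?c [^] n) \<otimes> r \<otimes> ?c [^] n) \<otimes> s = t \<longleftrightarrow> r = ?c [^] Suc (2 * n) \<otimes> s"
  proof -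
    have "?c [^] n \<otimes> (?c \<otimes> s) \<otimes> inv (?c [^] n) = ?c [^] n \<otimes> ?c \<otimes> (s \<otimes> inv (?c [^] n))" by simp
    also have "\<dots> = (?c [^] Suc n \<otimes> ?c [^] n) \<otimes> s" unfolding flip by simp
    also have "?c [^] Suc n \<otimes> ?c [^] n = ?c [^] Suc (2 * n)"
      by (simp only: nat_pow_mult m_closed gen_closed s t) (simp add: mult_2)
    finally have *: "?c [^] n \<otimes> (?c \<otimes> s) \<otimes> inv (?c [^] n) = ?c [^] Suc (2 * n) \<otimes> s" .
    have flip_conj: "s \<otimes> u \<otimes> s = t \<longleftrightarrow> u = ?c \<otimes> s" if "u \<in> carrier W" for u
      using that by (auto simp: m_assoc)
    have cl: "inv (?c [^] n) \<otimes> r \<otimes> ?c [^] n \<in> carrier W" "?c \<otimes> s \<in> carrier W" by simp_all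
    show ?thesis unfolding flip_conj[OF cl(1)] conj[OF cl(2)] * ..
  qed
  have "concat (replicate (Suc n) [s, t]) = ?R @ [s, t]"
    by (simp only: replicate_Suc replicate_append_same[symmetric] concat_append) simp
  moreover have "?R \<in> lists S" using s t by (rule alternating_in_lists)
  ultimately have "refl_parity (concat (replicate (Suc n) [s, t])) r \<longleftrightarrow>
      refl_parity ?R r \<noteq> refl_parity [s, t] (inv (?c [^] n) \<otimes> r \<otimes> ?c [^] n)"
    by (simp only: refl_parity_append r wp_alternating s t)
  also have "\<dots> \<longleftrightarrow> refl_parity ?R r \<noteq>
      ((r = ?c [^] (2 * n) \<otimes> s) \<noteq> (r = ?c [^] Suc (2 * n) \<otimes> s))"
    by (simp only: refl_parity.simps e1 e2 simp_thms)
  finally show ?case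
    unfolding Suc.IH by (simp del: nat_pow_Suc m_assoc)
qed simp

text \<open>
  For \<open>n = ord (s t)\<close> the sequence \<open>(s t)\<^sup>j s\<close>, \<open>j < 2 n\<close>, runs twice through the same period, so
  every element occurs an even number of times. If the order is infinite then \<open>n = 0\<close> and the
  word is empty.
\<close>

lemma refl_parity_relation:
  assumes s: "s \<in> S" and t: "t \<in> S" and r: "r \<in> carrier W"
  shows "\<not> refl_parity (concat (replicate (ord (s \<otimes> t)) [s, t])) r"
proof -
  let ?m = "ord (s \<otimes> t)"
  let ?f = "\<lambda>j. if r = (s \<otimes> t) [^] j \<otimes> s then 1 else 0 :: nat"
  have per: "(s \<otimes> t) [^] (j + ?m) = (s \<otimes> t) [^] j" for j
    using s t by (simp add: nat_pow_mult[symmetric])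
  have "(\<Sum>j<m + n. ?f j) = (\<Sum>j<m. ?f j) + (\<Sum>j<n. ?f (j + m))" for m n :: nat
    by (induction n) (simp_all add: add.commute add.left_commute del: nat_pow_Suc)
  then have "(\<Sum>j<2 * ?m. ?f j) = (\<Sum>j<?m. ?f j) + (\<Sum>j<?m. ?f (j + ?m))"
    unfolding mult_2 .
  also have "\<dots> = 2 * (\<Sum>j<?m. ?f j)" unfolding per by simp
  finally show ?thesis unfolding refl_parity_alternating[OF assms] by simp
qed

lemma refl_parity_step:
  assumes "coxeter_step W S us vs" "r \<in> carrier W"
  shows "refl_parity us r \<longleftrightarrow> refl_parity vs r"
proof -
  obtain s t xs ys where st: "s \<in> S" "t \<in> S" and xs: "xs \<in> lists S" and ys: "ys \<in> lists S"
    and us: "us = xs @ concat (replicate (ord (s \<otimes> t)) [s, t]) @ ys" and vs: "vs = xs @ ys"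
    using assms(1) unfolding coxeter_step_def by blast
  let ?R = "concat (replicate (ord (s \<otimes> t)) [s, t])"
  have R: "?R \<in> lists S" using st by (rule alternating_in_lists)
  have wpR: "wp ?R = \<one>" using st by (simp add: wp_alternating)
  let ?q = "inv (wp xs) \<otimes> r \<otimes> wp xs"
  have q: "?q \<in> carrier W" using xs assms(2) by simp
  have "refl_parity us r \<longleftrightarrow> refl_parity xs r \<noteq> (refl_parity ?R ?q \<noteq> refl_parity ys ?q)"
    unfolding us using q wpR by (simp add: refl_parity_append xs R assms(2))
  also have "\<dots> \<longleftrightarrow> refl_parity vs r"
    unfolding vs using refl_parity_relation[OF st q] by (simp add: refl_parity_append xs assms(2))
  finally show ?thesis .
qed

text \<open>
  The presentation enters here and only here: two words for the same element are connected by
  defining relations, each of which preserves the parity. For an arbitrary group generated by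
  involutions this fails, and so does the exchange condition.
\<close>

lemma refl_parity_cong:
  assumes "us \<in> lists S" "vs \<in> lists S" "wp us = wp vs" "r \<in> carrier W"
  shows "refl_parity us r \<longleftrightarrow> refl_parity vs r"
  using presentation[OF assms(1-3)]
proof (induction rule: equivclp_induct)
  case (step y z)
  then show ?case using refl_parity_step assms(4) by blast
qed simp

text \<open>
  An odd number is not zero, so \<open>t = s\<^sub>1 \<dots> s\<^sub>i \<dots> s\<^sub>1\<close> for some \<open>i\<close>, and multiplying the word by it from
  the left cancels the first \<open>i\<close> letters and puts back all of them but the last.
\<close>

lemma refl_parity_delete:
  assumes "refl_parity ws t" "ws \<in> lists S" "t \<in> carrier W"
  shows "\<exists>xs c ys. ws = xs @ c # ys \<and> t \<otimes> wp ws = wp (xs @ ys)"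
  using assms
proof (induction ws arbitrary: t)
  case (Cons s ws)
  then have s: "s \<in> S" and ws: "ws \<in> lists S" by auto
  show ?case
  proof (cases "t = s")
    case True
    then show ?thesis using s ws by (intro exI[of _ "[]"] exI[of _ s] exI[of _ ws]) simp
  next
    case False
    then have "refl_parity ws (s \<otimes> t \<otimes> s)" using Cons.prems by simp
    then obtain xs c ys where *: "ws = xs @ c # ys" "s \<otimes> t \<otimes> s \<otimes> wp ws = wp (xs @ ys)"
      using Cons.IH[of "s \<otimes> t \<otimes> s"] ws s Cons.prems by auto
    have "t \<otimes> wp (s # ws) = s \<otimes> (s \<otimes> t \<otimes> s \<otimes> wp ws)"
      using s ws Cons.prems by (simp add: m_assoc)
    also have "\<dots> = wp ((s # xs) @ ys)" using * by simp
    finally show ?thesis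
      using *(1) by (intro exI[of _ "s # xs"] exI[of _ c] exI[of _ ys]) simp
  qed
qed simp

text \<open>The deletion is applied to a reduced word, which has the same parity.\<close>

lemma refl_parity_imp_len_less:
  assumes "refl_parity ws s" "ws \<in> lists S" "s \<in> S"
  shows "len (s \<otimes> wp ws) < len (wp ws)"
proof -
  obtain vs where vs: "vs \<in> lists S" "wp vs = wp ws" "length vs = len (wp ws)"
    using obtain_reduced_word[of "wp ws"] assms by auto
  have "refl_parity vs s" using refl_parity_cong[of vs ws s] vs assms by simp
  then obtain xs c ys where d: "vs = xs @ c # ys" "s \<otimes> wp vs = wp (xs @ ys)"
    using refl_parity_delete vs assms by (metis gen_closed)
  have "len (wp (xs @ ys)) \<le> length (xs @ ys)" using d vs by (intro len_le) auto
  then show ?thesis using d vs by auto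
qed

text \<open>
  For any \<open>w\<close>, the parity at \<open>s\<close> is therefore odd for exactly one of \<open>w\<close> and \<open>s w\<close>, namely the
  longer one. This yields both the exchange condition and the fact that the two lengths differ.
\<close>

lemma refl_parity_gen_mult:
  assumes "s \<in> S"
  shows "refl_parity (s # ws) s \<longleftrightarrow> \<not> refl_parity ws s"
  using assms by simp

lemma left_exchange:
  assumes s: "s \<in> S" and ws: "ws \<in> lists S" and less: "len (s \<otimes> wp ws) < len (wp ws)"
  shows "\<exists>xs c ys. ws = xs @ c # ys \<and> s \<otimes> wp ws = wp (xs @ ys)"
proof -
  have "refl_parity ws s"
  proof (rule ccontr)
    assume "\<not> refl_parity ws s"
    then have "refl_parity (s # ws) s" using refl_parity_gen_mult[OF s] by blast
    from refl_parity_imp_len_less[OF this] show False using s ws less by simp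
  qed
  from refl_parity_delete[OF this] show ?thesis using s ws by simp
qed

lemma len_left_neq:
  assumes s: "s \<in> S" and w: "w \<in> carrier W"
  shows "len (s \<otimes> w) \<noteq> len w"
proof -
  obtain ws where ws: "ws \<in> lists S" "wp ws = w" using obtain_reduced_word[OF w] by blast
  have "refl_parity ws s \<or> refl_parity (s # ws) s" using refl_parity_gen_mult[OF s] by blast
  then show ?thesis
  proof
    assume "refl_parity ws s"
    from refl_parity_imp_len_less[OF this] show ?thesis using s ws by simp
  next
    assume "refl_parity (s # ws) s"
    from refl_parity_imp_len_less[OF this] have "len (s \<otimes> (s \<otimes> w)) < len (s \<otimes> w)"
      using s ws by simp
    then show ?thesis using s w by simp
  qed
qed

lemma len_mult_gen:
  assumes "s \<in> S" "w \<in> carrier W"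
  shows "len (w \<otimes> s) = len (s \<otimes> inv w)"
  using len_inv[of "w \<otimes> s"] assms by (simp add: inv_mult_group)

text \<open>Inversion reverses words and preserves length, which exchanges left and right.\<close>

lemma right_exchange:
  assumes s: "s \<in> S" and ws: "ws \<in> lists S" and less: "len (wp ws \<otimes> s) < len (wp ws)"
  shows "\<exists>xs c ys. ws = xs @ c # ys \<and> wp ws \<otimes> s = wp (xs @ ys)"
proof -
  have "len (s \<otimes> wp (rev ws)) < len (wp (rev ws))"
    using less s ws by (simp add: wp_rev len_mult_gen len_inv)
  then obtain xs c ys where d: "rev ws = xs @ c # ys" "s \<otimes> wp (rev ws) = wp (xs @ ys)"
    using left_exchange[of s "rev ws"] s ws by auto
  have ws': "ws = rev ys @ c # rev xs"
    using arg_cong[OF d(1), of rev] by simp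
  have "xs @ ys \<in> lists S" using ws unfolding ws' by auto
  have "wp ws \<otimes> s = inv (s \<otimes> wp (rev ws))" using s ws by (simp add: wp_rev inv_mult_group)
  also have "\<dots> = wp (rev (xs @ ys))" unfolding d(2) wp_rev[OF \<open>xs @ ys \<in> lists S\<close>] ..
  finally show ?thesis using ws' by (intro exI[of _ "rev ys"] exI[of _ c] exI[of _ "rev xs"]) simp
qed


section \<open>Minimal double coset representatives\<close>

definition double_reps :: "'a set \<Rightarrow> 'a set \<Rightarrow> 'a set" where
  "double_reps I J = {d \<in> min_coset_reps W S J. inv d \<in> min_coset_reps W S I}"

lemma double_reps_iff:
  assumes "I \<subseteq> S"
  shows "d \<in> double_reps I J \<longleftrightarrow> d \<in> carrier W \<and>
    (\<forall>s\<in>I. len d < len (s \<otimes> d)) \<and> (\<forall>s\<in>J. len d < len (d \<otimes> s))"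
proof -
  have "len (inv d \<otimes> s) = len (s \<otimes> d)" if "d \<in> carrier W" "s \<in> I" for s
    using that assms by (subst len_mult_gen) auto
  then show ?thesis
    unfolding double_reps_def min_coset_reps_def by (auto simp: len_inv)
qed

text \<open>
  The uniqueness argument on words. The word \<open>vs\<close> is assumed to be as short as any middle part
  of a factorization of the given element into a word over \<open>I\<close>, a word over \<open>S\<close> and a word over
  \<open>J\<close>; among the factorizations with middle part \<open>vs\<close> one with outer parts of least total length
  is taken. If its left part starts with \<open>s \<in> I\<close>, then \<open>s d\<close>, which is longer than \<open>d\<close>, is represented
  by the word without this \<open>s\<close>, and by the exchange condition \<open>d\<close> itself is obtained by deleting
  a further letter of that word. This contradicts one of the two choices.
\<close>

lemma double_reps_minimal_eq:
  assumes I: "I \<subseteq> S" and J: "J \<subseteq> S"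
    and vs: "vs \<in> lists S"
    and min: "\<And>us ws zs. us \<in> lists I \<Longrightarrow> ws \<in> lists S \<Longrightarrow> zs \<in> lists J \<Longrightarrow>
      wp (us @ ws @ zs) = wp (us0 @ vs @ zs0) \<Longrightarrow> length vs \<le> length ws"
    and us0: "us0 \<in> lists I" and zs0: "zs0 \<in> lists J"
    and d: "wp (us0 @ vs @ zs0) \<in> double_reps I J"
  shows "wp (us0 @ vs @ zs0) = wp vs"
proof -
  let ?d = "wp (us0 @ vs @ zs0)"
  have sub: "lists I \<subseteq> lists S" "lists J \<subseteq> lists S" using I J by auto
  define P where "P us zs \<longleftrightarrow> us \<in> lists I \<and> zs \<in> lists J \<and> wp (us @ vs @ zs) = ?d" for us zs
  have "P us0 zs0" using us0 zs0 unfolding P_def by simp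
  then obtain us zs where P: "P us zs"
    and least: "\<And>us' zs'. P us' zs' \<Longrightarrow> length us + length zs \<le> length us' + length zs'"
    using exists_least_iff[of "\<lambda>n. \<exists>us zs. P us zs \<and> length us + length zs = n"]
    by (metis linorder_not_less)
  have words: "us \<in> lists I" "zs \<in> lists J" "us \<in> lists S" "zs \<in> lists S"
    using P sub unfolding P_def by auto
  \<comment> \<open>Deleting a letter from such a word never gives a word for the element: a letter deleted in an
    outer part contradicts \<open>least\<close>, one deleted in the middle part contradicts \<open>min\<close>.\<close>
  have nodel: False
    if del: "us' @ vs @ zs' = xs @ c # ys" and eq: "wp (xs @ ys) = ?d"
      and u': "us' \<in> lists I" and z': "zs' \<in> lists J"
      and le: "length us' + length zs' \<le> length us + length zs" for us' zs' xs c ys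
  proof -
    consider (left) r where "us' = xs @ c # r" "ys = r @ vs @ zs'"
      | (mid) p r where "xs = us' @ p" "vs = p @ c # r" "ys = r @ zs'"
      | (right) p where "xs = us' @ vs @ p" "zs' = p @ c # ys"
      using del by (auto simp: append_eq_append_conv2 append_eq_Cons_conv Cons_eq_append_conv)
    then show False
    proof cases
      case left
      then have "P (xs @ r) zs'" using u' z' eq unfolding P_def by auto
      from least[OF this] left le show False by simp
    next
      case mid
      then have "length vs \<le> length (p @ r)" using u' z' eq vs by (intro min[of us' _ zs']) auto
      with mid show False by simp
    next
      case right
      then have "P us' (p @ ys)" using u' z' eq unfolding P_def by auto
      from least[OF this] right le show False by simp
    qed
  qed
  have up: "\<forall>s\<in>I. len ?d < len (s \<otimes> ?d)" "\<forall>s\<in>J. len ?d < len (?d \<otimes> s)" "?d \<in> carrier W"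
    using d double_reps_iff[OF I] by auto
  have "us = []"
  proof (cases us)
    case (Cons s us')
    then have s: "s \<in> I" "s \<in> S" and u': "us' \<in> lists I" "us' \<in> lists S" using words I by auto
    let ?v = "us' @ vs @ zs"
    have v: "?v \<in> lists S" using u' vs words by simp
    have dv: "?d = s \<otimes> wp ?v" using P Cons unfolding P_def by simp
    have "wp ?v = s \<otimes> ?d" unfolding dv using s v by simp
    then have "len (s \<otimes> wp ?v) < len (wp ?v)" using up(1) s dv by metis
    from left_exchange[OF s(2) v this] obtain xs c ys
      where "?v = xs @ c # ys" "s \<otimes> wp ?v = wp (xs @ ys)" by blast
    then show ?thesis using nodel[of us' zs xs c ys] u' words dv Cons by simp
  qed
  moreover have "zs = []"
  proof (cases zs rule: rev_cases)
    case (snoc zs' s)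
    then have s: "s \<in> J" "s \<in> S" and z': "zs' \<in> lists J" "zs' \<in> lists S" using words J by auto
    let ?v = "us @ vs @ zs'"
    have v: "?v \<in> lists S" using z' vs words by simp
    have "?d = wp (?v @ [s])" using P snoc unfolding P_def by simp
    then have dv: "?d = wp ?v \<otimes> s" using v s by (subst (asm) wp_append) auto
    have "wp ?v = ?d \<otimes> s" unfolding dv using s v by (simp add: m_assoc)
    then have "len (wp ?v \<otimes> s) < len (wp ?v)" using up(2) s dv by metis
    from right_exchange[OF s(2) v this] obtain xs c ys
      where "?v = xs @ c # ys" "wp ?v \<otimes> s = wp (xs @ ys)" by blast
    then show ?thesis using nodel[of us zs' xs c ys] z' words dv snoc by simp
  qed simp
  ultimately show ?thesis using P unfolding P_def by simp
qed

text \<open>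
  The representative is an element \<open>e\<close> of least length in the double coset \<open>W\<^sub>I c W\<^sub>J\<close>. It lies in
  the set of distinguished elements because multiplication by a generator never preserves the
  length, and any other distinguished element is compared with it through a reduced word of \<open>e\<close>.
\<close>

lemma double_reps_unique:
  assumes I: "I \<subseteq> S" and J: "J \<subseteq> S" and c: "c \<in> carrier W"
  shows "\<exists>!d. d \<in> double_reps I J \<and> (\<exists>h\<in>generate W I. \<exists>k\<in>generate W J. d = h \<otimes> c \<otimes> k)"
proof -
  let ?H = "generate W I" and ?K = "generate W J"
  note [simp] = cancel_left m_assoc inv_mult_group c
  note H = parabolic_subgroup[OF I] and K = parabolic_subgroup[OF J]
  have HG [simp]: "h \<in> carrier W" if "h \<in> ?H" for h using that subgroup.mem_carrier[OF H] by simp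
  have KG [simp]: "k \<in> carrier W" if "k \<in> ?K" for k using that subgroup.mem_carrier[OF K] by simp
  define C where "C = {x. \<exists>h\<in>?H. \<exists>k\<in>?K. x = h \<otimes> c \<otimes> k}"
  have CG: "x \<in> carrier W" if "x \<in> C" for x using that unfolding C_def by auto
  have mult: "h \<otimes> x \<otimes> k \<in> C" if "x \<in> C" "h \<in> ?H" "k \<in> ?K" for x h k
  proof -
    obtain h' k' where x: "x = h' \<otimes> c \<otimes> k'" "h' \<in> ?H" "k' \<in> ?K"
      using \<open>x \<in> C\<close> unfolding C_def by auto
    then have "h \<otimes> x \<otimes> k = (h \<otimes> h') \<otimes> c \<otimes> (k' \<otimes> k)" using that by simp
    then show ?thesis
      using x that subgroup.m_closed[OF H] subgroup.m_closed[OF K] unfolding C_def by blast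
  qed
  have one: "\<one> \<in> ?H" "\<one> \<in> ?K" using H K by (auto simp: subgroup.one_closed)
  have "\<one> \<otimes> c \<otimes> \<one> \<in> C" unfolding C_def using one by blast
  then have cC: "c \<in> C" by simp
  define e where "e = arg_min len (\<lambda>x. x \<in> C)"
  have e: "e \<in> C" and emin: "\<And>x. x \<in> C \<Longrightarrow> len e \<le> len x"
    using arg_min_nat_lemma[of "\<lambda>x. x \<in> C" c len] cC unfolding e_def by auto
  have "e \<in> double_reps I J"
  proof -
    have "len e < len (s \<otimes> e)" if s: "s \<in> I" for s
    proof -
      have "s \<otimes> e \<otimes> \<one> \<in> C" using mult[OF e _ one(2), of s] s by (simp add: generate.incl)
      then show ?thesis
        using emin[of "s \<otimes> e"] len_left_neq[of s e] s I CG[OF e]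
        by (metis gen_closed le_neq_implies_less m_closed r_one subsetD)
    qed
    moreover have "len e < len (e \<otimes> s)" if s: "s \<in> J" for s
    proof -
      have sS: "s \<in> S" using s J by auto
      have "\<one> \<otimes> e \<otimes> s \<in> C" using mult[OF e one(1), of s] s by (simp add: generate.incl)
      then have "len e \<le> len (e \<otimes> s)" using emin CG[OF e] by simp
      moreover have "len (e \<otimes> s) \<noteq> len e"
        using len_left_neq[OF sS, of "inv e"] len_mult_gen[OF sS CG[OF e]] len_inv[OF CG[OF e]] CG[OF e]
        by simp
      ultimately show ?thesis by simp
    qed
    ultimately show ?thesis using double_reps_iff[OF I] CG[OF e] by simp
  qed
  moreover have "x = e" if x: "x \<in> C" "x \<in> double_reps I J" for x
  proof -
    obtain vs where vs: "vs \<in> lists S" "wp vs = e" "length vs = len e"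
      using obtain_reduced_word[OF CG[OF e]] by blast
    obtain h k where hk: "x = h \<otimes> e \<otimes> k" "h \<in> ?H" "k \<in> ?K"
    proof -
      obtain h1 k1 where 1: "x = h1 \<otimes> c \<otimes> k1" "h1 \<in> ?H" "k1 \<in> ?K"
        using x(1) unfolding C_def by auto
      obtain h2 k2 where 2: "e = h2 \<otimes> c \<otimes> k2" "h2 \<in> ?H" "k2 \<in> ?K"
        using e unfolding C_def by auto
      have "x = (h1 \<otimes> inv h2) \<otimes> e \<otimes> (inv k2 \<otimes> k1)" using 1 2 by simp
      moreover have "h1 \<otimes> inv h2 \<in> ?H" using 1 2 H by (metis subgroup.m_closed subgroup.m_inv_closed)
      moreover have "inv k2 \<otimes> k1 \<in> ?K" using 1 2 K by (metis subgroup.m_closed subgroup.m_inv_closed)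
      ultimately show ?thesis using that by blast
    qed
    obtain us zs where us: "us \<in> lists I" "wp us = h" and zs: "zs \<in> lists J" "wp zs = k"
      using hk parabolic_words[OF I] parabolic_words[OF J] by auto
    have sub: "lists I \<subseteq> lists S" "lists J \<subseteq> lists S" using I J by auto
    have xw: "wp (us @ vs @ zs) = x"
      using us zs vs hk sub CG[OF e] by (simp add: wp_append subset_iff)
    have "wp (us @ vs @ zs) = wp vs"
    proof (rule double_reps_minimal_eq[OF I J vs(1) _ us(1) zs(1)])
      show "wp (us @ vs @ zs) \<in> double_reps I J" using x xw by simp
      fix us' ws' zs'
      assume *: "us' \<in> lists I" "ws' \<in> lists S" "zs' \<in> lists J"
        "wp (us' @ ws' @ zs') = wp (us @ vs @ zs)"
      then have m: "wp us' \<in> ?H" "wp zs' \<in> ?K" "us' \<in> lists S" "zs' \<in> lists S"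
        using parabolic_words[OF I] parabolic_words[OF J] sub by auto
      have "x = wp us' \<otimes> (wp ws' \<otimes> wp zs')" using * m xw by (simp add: wp_append)
      then have "wp ws' = inv (wp us') \<otimes> x \<otimes> inv (wp zs')" using * m by simp
      then have "wp ws' \<in> C"
        using mult[OF x(1)] m H K by (metis subgroup.m_inv_closed)
      then show "length vs \<le> length ws'" using emin len_le[OF *(2)] vs by fastforce
    qed
    then show ?thesis using xw vs by simp
  qed
  ultimately have "\<exists>!d. d \<in> double_reps I J \<and> d \<in> C" using e by auto
  then show ?thesis unfolding C_def mem_Collect_eq .
qed


section \<open>The two forms on the descent algebra\<close>

lemma inner_parabolic_char:
  assumes "finite (carrier W)" "I \<subseteq> S" "J \<subseteq> S"
  shows "class_fun_inner W (parabolic_char W I) (parabolic_char W J)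
    = of_nat (card (double_reps I J))"
  unfolding parabolic_char_def
  by (intro inner_induced_trivial assms parabolic_subgroup double_reps_unique)
    (auto simp: double_reps_def min_coset_reps_def)

lemma form_descent_elt:
  assumes fin: "finite (carrier W)"
  shows "group_algebra_form W (descent_elt W S I) (descent_elt W S J)
    = of_nat (card (double_reps I J))"
proof -
  let ?X = "min_coset_reps W S"
  have "group_algebra_form W (descent_elt W S I) (descent_elt W S J)
      = (\<Sum>g\<in>carrier W. \<Sum>w\<in>carrier W. if w = inv g then (if w \<in> ?X I \<and> g \<in> ?X J then 1 else 0) else 0)"
    unfolding group_algebra_form_def descent_elt_def
    by (subst sum.swap) (intro sum.cong refl, auto)
  also have "\<dots> = (\<Sum>g\<in>carrier W. if g \<in> double_reps I J then 1 else 0)"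
    using fin by (intro sum.cong refl) (auto simp: sum.delta double_reps_def)
  also have "\<dots> = of_nat (card {g \<in> carrier W. g \<in> double_reps I J})"
    using fin by (simp flip: sum.inter_filter)
  also have "{g \<in> carrier W. g \<in> double_reps I J} = double_reps I J"
    by (auto simp: double_reps_def min_coset_reps_def)
  finally show ?thesis .
qed

end

lemma additive_homogeneous_sum:
  fixes F :: "('a \<Rightarrow> rat) \<Rightarrow> rat"
  assumes add: "\<And>x y. F (x + y) = F x + F y" and scale: "\<And>c x. F (fun_scale c x) = c * F x"
  shows "F (\<Sum>i\<in>A. fun_scale (a i) (u i)) = (\<Sum>i\<in>A. a i * F (u i))"
proof -
  have "F 0 = 0" using scale[of 0 0] by simp
  then show ?thesis
    by (induction A rule: infinite_finite_induct) (simp_all only: sum.infinite sum.empty sum.insert add scale not_False_eq_True)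
qed

lemma bilinear_sums:
  fixes \<beta> :: "('a \<Rightarrow> rat) \<Rightarrow> ('a \<Rightarrow> rat) \<Rightarrow> rat"
  assumes "\<And>f f' g. \<beta> (f + f') g = \<beta> f g + \<beta> f' g" "\<And>c f g. \<beta> (fun_scale c f) g = c * \<beta> f g"
    and "\<And>f g g'. \<beta> f (g + g') = \<beta> f g + \<beta> f g'" "\<And>c f g. \<beta> f (fun_scale c g) = c * \<beta> f g"
  shows "\<beta> (\<Sum>i\<in>A. fun_scale (a i) (u i)) (\<Sum>j\<in>B. fun_scale (b j) (v j))
    = (\<Sum>i\<in>A. a i * (\<Sum>j\<in>B. b j * \<beta> (u i) (v j)))"
proof -
  have left: "\<beta> (\<Sum>i\<in>A. fun_scale (a i) (u i)) g = (\<Sum>i\<in>A. a i * \<beta> (u i) g)" for g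
    using assms(1,2) by (rule additive_homogeneous_sum)
  have right: "\<beta> f (\<Sum>j\<in>B. fun_scale (b j) (v j)) = (\<Sum>j\<in>B. b j * \<beta> f (v j))" for f
    using assms(3,4) by (rule additive_homogeneous_sum)
  show ?thesis unfolding left unfolding right ..
qed

lemma class_fun_inner_sums:
  "class_fun_inner W (\<Sum>i\<in>A. fun_scale (a i) (u i)) (\<Sum>j\<in>B. fun_scale (b j) (v j))
    = (\<Sum>i\<in>A. a i * (\<Sum>j\<in>B. b j * class_fun_inner W (u i) (v j)))"
  by (rule bilinear_sums)
    (simp_all add: class_fun_inner_def fun_scale_def algebra_simps sum.distrib sum_distrib_left)

lemma group_algebra_form_sums:
  "group_algebra_form W (\<Sum>i\<in>A. fun_scale (a i) (u i)) (\<Sum>j\<in>B. fun_scale (b j) (v j))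
    = (\<Sum>i\<in>A. a i * (\<Sum>j\<in>B. b j * group_algebra_form W (u i) (v j)))"
  by (rule bilinear_sums)
    (simp_all add: group_algebra_form_def fun_scale_def algebra_simps sum.distrib sum_distrib_left)

theorem theorem3p1:
  fixes W :: "('a, 'b) monoid_scheme" and S :: "'a set" and x y :: "'a \<Rightarrow> rat"
  assumes "coxeter_system W S"
    and "finite (carrier W)"
    and "x \<in> descent_algebra W S"
    and "y \<in> descent_algebra W S"
  shows "class_fun_inner W (solomon_hom W S x) (solomon_hom W S y) = group_algebra_form W x y"
proof -
  interpret coxeter_system W S by fact
  let ?a = "descent_coeffs W S x" and ?b = "descent_coeffs W S y"
  have fin: "finite S" using assms(2) gens_subset by (rule finite_subset[rotated])
  have "class_fun_inner W (solomon_hom W S x) (solomon_hom W S y) =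
      (\<Sum>I\<in>Pow S. ?a I * (\<Sum>J\<in>Pow S. ?b J * class_fun_inner W (parabolic_char W I) (parabolic_char W J)))"
    unfolding solomon_hom_def by (rule class_fun_inner_sums)
  also have "\<dots> = (\<Sum>I\<in>Pow S. ?a I * (\<Sum>J\<in>Pow S. ?b J *
      group_algebra_form W (descent_elt W S I) (descent_elt W S J)))"
    using assms(2) by (intro sum.cong refl arg_cong2[where f = "(*)"])
      (simp add: inner_parabolic_char form_descent_elt)
  also have "\<dots> = group_algebra_form W (\<Sum>I\<in>Pow S. fun_scale (?a I) (descent_elt W S I))
      (\<Sum>J\<in>Pow S. fun_scale (?b J) (descent_elt W S J))"
    by (rule group_algebra_form_sums[symmetric])
  also have "\<dots> = group_algebra_form W x y"
    using descent_coeffs[OF fin assms(3)] descent_coeffs[OF fin assms(4)] by simp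
  finally show ?thesis .
qed

end
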